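(* Let $\alpha>0$. The dynamics $$\dot q=\tfrac12q\Omega-\alpha(|q|^2-1)q,\qquad \dot\Omega=\mathbb I^{-1}((\mathbb I\Omega)\times\Omega)+\mathbb I^{-1}\tau \qquad (\mathrm E)$$ on $\mathbb H\times\mathbb R^3$ reduces on ${\rm S}^3\times\mathbb R^3$ to the dynamics $$\dot q=\tfrac12q\Omega,\qquad \dot\Omega=\mathbb I^{-1}((\mathbb I\Omega)\times\Omega)+\mathbb I^{-1}\tau .$$ Moreover, ${\rm S}^3\times\mathbb R^3$ is an invariant set of $(\mathrm E)$, and a local exponential attractor of $(\mathrm E)$ with the region of convergence $\mathbb H_0\times\mathbb R^3$.
   Context: $\mathbb H$ is the set of quaternions with its usual product and Euclidean norm $|q|$; ${\rm S}^3=\{q\in\mathbb H:|q|=1\}$ and $\mathbb H_0=\{q\in\mathbb H: q\ne0\}$. Vectors $\Omega\in\mathbb R^3$ are identified with pure quaternions (zero scalar part), so $q\Omega$ is a quaternion product; $\times$ is the cross product on $\mathbb R^3$. $\mathbb I\in\mathbb R^{3\times3}$ is the moment-of-inertia matrix of a rigid body (symmetric positive definite), and $\tau\in\mathbb R^3$ is the control input. "Local exponential attractor with region of convergence $\mathbb H_0\times\mathbb R^3$" means: trajectories starting near ${\rm S}^3\times\mathbb R^3$ converge to it exponentially (in the sense that $|q(t)|^2\to1$ exponentially), and every trajectory starting in $\mathbb H_0\times\mathbb R^3$ converges to ${\rm S}^3\times\mathbb R^3$ (that is, $|q(t)|^2\to1$) as $t\to\infty$. Inputs $\tau$ are understood to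 be such that solutions exist for all $t\ge0$. *)

theory Defs
  imports "HOL-Analysis.Analysis"
begin

text \<open>A quaternion is the pair (scalar part, vector part). The product-type norm on
  \<^typ>\<open>real \<times> (real^3)\<close> is then the Euclidean norm of the quaternion.\<close>

type_synonym quat = "real \<times> (real^3)"

type_synonym state = "quat \<times> (real^3)"

definition qmult :: "quat \<Rightarrow> quat \<Rightarrow> quat" where
  "qmult p q = (fst p * fst q - snd p \<bullet> snd q,
                fst p *\<^sub>R snd q + fst q *\<^sub>R snd p + cross3 (snd p) (snd q))"

definition pure_quat :: "real^3 \<Rightarrow> quat" where
  "pure_quat v = (0, v)"

definition S3 :: "quat set" where
  "S3 = {q. norm q = 1}"

definition H0 :: "quat set" where
  "H0 = {q. q \<noteq> 0}"

lemma qmult_units: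
  defines "i \<equiv> pure_quat (axis 1 1)" and "j \<equiv> pure_quat (axis 2 1)"
    and "k \<equiv> pure_quat (axis 3 1)"
  shows "qmult i i = (-1, 0)" "qmult j j = (-1, 0)" "qmult k k = (-1, 0)"
    "qmult i j = k" "qmult j k = i" "qmult k i = j"
    "qmult j i = - k" "qmult k j = - i" "qmult i k = - j"
  unfolding assms
  by (simp_all add: qmult_def pure_quat_def cross3_def axis_def vec_eq_iff forall_3
      inner_vec_def sum_3)

lemma norm_qmult: "norm (qmult p q) = norm p * norm q"
proof -
  have "(norm (qmult p q))\<^sup>2 = (norm p * norm q)\<^sup>2"
    unfolding power_mult_distrib
    by (simp add: power2_norm_eq_inner qmult_def inner_prod_def cross3_def inner_vec_def
        sum_3) algebra
  then show ?thesis
    by simp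
qed

text \<open>At an endpoint of \<open>J\<close> the derivative is one-sided.\<close>

definition solution ::
  "(real \<Rightarrow> 'a::real_normed_vector \<Rightarrow> 'a) \<Rightarrow> real set \<Rightarrow> (real \<Rightarrow> 'a) \<Rightarrow> bool" where
  "solution f J x \<longleftrightarrow> (\<forall>t\<in>J. (x has_vector_derivative f t (x t)) (at t within J))"

text \<open>The control \<open>\<tau>\<close> may depend on time and on the state, so both open-loop inputs and
  state feedback are covered.\<close>

definition rigid_body ::
  "real^3^3 \<Rightarrow> (real \<Rightarrow> state \<Rightarrow> real^3) \<Rightarrow> real \<Rightarrow> state \<Rightarrow> real^3" where
  "rigid_body I \<tau> t x =
     matrix_inv I *v cross3 (I *v snd x) (snd x) + matrix_inv I *v \<tau> t x"

definition extended_dynamics ::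
  "real \<Rightarrow> real^3^3 \<Rightarrow> (real \<Rightarrow> state \<Rightarrow> real^3) \<Rightarrow> real \<Rightarrow> state \<Rightarrow> state" where
  "extended_dynamics \<alpha> I \<tau> t x =
     ((1/2) *\<^sub>R qmult (fst x) (pure_quat (snd x)) - (\<alpha> * ((norm (fst x))\<^sup>2 - 1)) *\<^sub>R fst x,
      rigid_body I \<tau> t x)"

definition attitude_dynamics ::
  "real^3^3 \<Rightarrow> (real \<Rightarrow> state \<Rightarrow> real^3) \<Rightarrow> real \<Rightarrow> state \<Rightarrow> state" where
  "attitude_dynamics I \<tau> t x =
     ((1/2) *\<^sub>R qmult (fst x) (pure_quat (snd x)), rigid_body I \<tau> t x)"

text \<open>The vector fields agree on \<open>M\<close>, and the trajectories through points of \<open>M\<close> are the same.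
  The second part does not follow from the first: a trajectory through a point of \<open>M\<close>
  could leave \<open>M\<close>.\<close>

definition reduces_on ::
  "(real \<Rightarrow> 'a::real_normed_vector \<Rightarrow> 'a) \<Rightarrow> 'a set \<Rightarrow> (real \<Rightarrow> 'a \<Rightarrow> 'a) \<Rightarrow> bool" where
  "reduces_on f M g \<longleftrightarrow>
     (\<forall>t. \<forall>x\<in>M. f t x = g t x) \<and>
     (\<forall>J x t\<^sub>0. is_interval J \<and> t\<^sub>0 \<in> J \<and> x t\<^sub>0 \<in> M \<longrightarrow> (solution f J x \<longleftrightarrow> solution g J x))"

text \<open>Invariance both forward and backward in time, on any interval of existence.\<close>

definition invariant_set ::
  "(real \<Rightarrow> 'a::real_normed_vector \<Rightarrow> 'a) \<Rightarrow> 'a set \<Rightarrow> bool" where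
  "invariant_set f M \<longleftrightarrow>
     (\<forall>J x t\<^sub>0. is_interval J \<and> solution f J x \<and> t\<^sub>0 \<in> J \<and> x t\<^sub>0 \<in> M \<longrightarrow> (\<forall>t\<in>J. x t \<in> M))"

text \<open>Trajectories are solutions on the whole half-line \<open>{0..}\<close>. Exponential convergence is
  uniform over a tube around \<open>S3 \<times> UNIV\<close>, with a bound proportional to the initial deviation
  of \<open>|q|\<^sup>2\<close> from 1.\<close>

definition S3_local_exponential_attractor ::
  "(real \<Rightarrow> state \<Rightarrow> state) \<Rightarrow> bool" where
  "S3_local_exponential_attractor f \<longleftrightarrow>
     (\<exists>\<delta>>0. \<exists>K>0. \<exists>c>0. \<forall>x. solution f {0..} x \<and> infdist (x 0) (S3 \<times> UNIV) < \<delta> \<longrightarrow>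
        (\<forall>t\<ge>0. \<bar>(norm (fst (x t)))\<^sup>2 - 1\<bar>
                  \<le> K * exp (- c * t) * \<bar>(norm (fst (x 0)))\<^sup>2 - 1\<bar>))"

definition S3_region_of_convergence ::
  "(real \<Rightarrow> state \<Rightarrow> state) \<Rightarrow> state set \<Rightarrow> bool" where
  "S3_region_of_convergence f R \<longleftrightarrow>
     (\<forall>x. solution f {0..} x \<and> x 0 \<in> R \<longrightarrow>
        ((\<lambda>t. (norm (fst (x t)))\<^sup>2) \<longlongrightarrow> 1) at_top)"

end

theory Submission
  imports Defs
begin

text \<open>Since \<open>\<Omega>\<close> is pure, \<open>q\<Omega>\<close> is orthogonal to \<open>q\<close>, so \<open>s = |q|\<^sup>2\<close> obeys the logistic equation
  \<open>s' = 2\<alpha> s (1 - s)\<close> whatever the input does. Its solution satisfies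
  \<open>(1 - s(t)) exp (2\<alpha>(t - t\<^sub>0)) s(t\<^sub>0) = (1 - s(t\<^sub>0)) s(t)\<close>, which gives invariance when
  \<open>s(t\<^sub>0) = 1\<close> and exponential decay of \<open>s - 1\<close> when \<open>s(t\<^sub>0) > 0\<close>.\<close>

text \<open>Uniqueness of the zero solution by an integrating factor: with \<open>B\<close> an
  antiderivative of \<open>b\<close>, the product \<open>w u * exp (- B u)\<close> has zero
  derivative, and the exponential never vanishes.\<close>

lemma linear_ode_eq_zero:
  fixes w b :: "real \<Rightarrow> real"
  assumes J: "is_interval J"
    and w: "\<And>t. t \<in> J \<Longrightarrow> (w has_real_derivative b t * w t) (at t within J)"
    and b: "continuous_on J b"
    and mem: "t\<^sub>0 \<in> J" "t \<in> J"
    and "w t\<^sub>0 = 0"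
  shows "w t = 0"
proof -
  \<comment> \<open>\<open>K\<close> treats times before and after \<open>t\<^sub>0\<close> alike.
    It is compact, so \<open>b\<close> is integrable on it; \<open>B\<close> starts at its left end
    rather than at \<open>t\<^sub>0\<close>.\<close>
  define K where "K = {min t\<^sub>0 t..max t\<^sub>0 t}"
  have ends: "min t\<^sub>0 t \<in> J" "max t\<^sub>0 t \<in> J"
    using mem by (simp_all add: min_def max_def)
  have KJ: "K \<subseteq> J"
  proof
    fix u
    assume "u \<in> K"
    then show "u \<in> J"
      by (intro mem_is_interval_1_I[OF J ends]) (simp_all only: K_def atLeastAtMost_iff)
  qed
  define B where "B u = integral {min t\<^sub>0 t..u} b" for u
  have B: "(B has_vector_derivative b u) (at u within K)" if "u \<in> K" for u
    unfolding B_def K_def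
    by (rule integral_has_vector_derivative[OF continuous_on_subset[OF b KJ[unfolded K_def]]
          that[unfolded K_def]])
  have "((\<lambda>u. w u * exp (- B u)) has_real_derivative 0) (at u within K)" if u: "u \<in> K" for u
  proof -
    have B': "(B has_real_derivative b u) (at u within K)"
      using B[OF u] by (simp add: has_real_derivative_iff_has_vector_derivative)
    have w': "(w has_real_derivative b u * w u) (at u within K)"
      using w KJ u by (blast intro: DERIV_subset)
    show ?thesis
      by (rule DERIV_cong[OF DERIV_mult[OF w' DERIV_chain2[OF DERIV_exp DERIV_minus[OF B']]]]) simp
  qed
  then have "\<exists>c. \<forall>u\<in>K. w u * exp (- B u) = c"
    by (intro has_field_derivative_zero_constant) (simp_all add: K_def)
  then obtain c where c: "\<And>u. u \<in> K \<Longrightarrow> w u * exp (- B u) = c"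
    by blast
  have "t\<^sub>0 \<in> K" "t \<in> K"
    by (auto simp: K_def)
  then have "w t * exp (- B t) = w t\<^sub>0 * exp (- B t\<^sub>0)"
    by (metis c)
  then show ?thesis
    using \<open>w t\<^sub>0 = 0\<close> by simp
qed

text \<open>The difference \<open>w\<close> of the two sides vanishes at \<open>t\<^sub>0\<close>
  and, along the given \<open>s\<close>, solves a linear equation with coefficient
  \<open>k * (1 - s u)\<close>. The identity is free of division, so the value
  \<open>s t\<^sub>0 = 0\<close> is covered as well.\<close>

lemma logistic_first_integral:
  fixes s :: "real \<Rightarrow> real"
  assumes J: "is_interval J"
    and s: "\<And>t. t \<in> J \<Longrightarrow> (s has_real_derivative k * s t * (1 - s t)) (at t within J)"
    and mem: "t\<^sub>0 \<in> J" "t \<in> J"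
  shows "(1 - s t) * exp (k * (t - t\<^sub>0)) * s t\<^sub>0 = (1 - s t\<^sub>0) * s t"
proof -
  define w where "w u = (1 - s u) * exp (k * (u - t\<^sub>0)) * s t\<^sub>0 - (1 - s t\<^sub>0) * s u" for u
  have "continuous_on J s"
    by (rule DERIV_continuous_on[OF s])
  then have b: "continuous_on J (\<lambda>u. k * (1 - s u))"
    by (intro continuous_intros)
  have "(w has_real_derivative k * (1 - s u) * w u) (at u within J)" if "u \<in> J" for u
    unfolding w_def
    by (rule derivative_eq_intros s[OF that] refl)+ (simp add: algebra_simps)
  from linear_ode_eq_zero[OF J this b mem] show ?thesis
    by (simp add: w_def)
qed

text \<open>The two products of the scalar part of \<open>q\<close> with the inner product of the
  vector parts cancel, and the cross product is orthogonal to its first factor.\<close>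

lemma inner_qmult_pure_quat: "q \<bullet> qmult q (pure_quat v) = 0"
  by (simp add: qmult_def pure_quat_def inner_prod_def inner_add_right dot_cross_self)

lemma norm_power2_has_derivative:
  assumes "(x has_vector_derivative x') (at t within J)"
  shows "((\<lambda>t. (norm (fst (x t)))\<^sup>2) has_real_derivative 2 * (fst (x t) \<bullet> fst x')) (at t within J)"
proof -
  have "((\<lambda>t. fst (x t)) has_derivative (\<lambda>h. fst (h *\<^sub>R x'))) (at t within J)"
    using assms unfolding has_vector_derivative_def by (rule has_derivative_fst)
  from has_derivative_inner[OF this this] show ?thesis
    unfolding has_field_derivative_def power2_norm_eq_inner
    by (rule has_derivative_eq_rhs) (auto simp: fun_eq_iff inner_commute)
qed

lemma extended_norm_derivative:
  assumes "solution (extended_dynamics \<alpha> I \<tau>) J x" "t \<in> J"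
  shows "((\<lambda>t. (norm (fst (x t)))\<^sup>2) has_real_derivative
           2 * \<alpha> * (norm (fst (x t)))\<^sup>2 * (1 - (norm (fst (x t)))\<^sup>2)) (at t within J)"
proof -
  have "(x has_vector_derivative extended_dynamics \<alpha> I \<tau> t (x t)) (at t within J)"
    using assms by (simp add: solution_def)
  from norm_power2_has_derivative[OF this] show ?thesis
    by (rule DERIV_cong)
      (simp add: extended_dynamics_def inner_diff_right inner_qmult_pure_quat
        flip: power2_norm_eq_inner, simp add: algebra_simps)
qed

text \<open>Serves the converse half of the reduction: a trajectory of the reduced dynamics that
  meets the sphere never leaves it.\<close>

lemma attitude_norm_constant:
  assumes J: "is_interval J" and x: "solution (attitude_dynamics I \<tau>) J x"
    and mem: "t\<^sub>0 \<in> J" "t \<in> J"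
  shows "norm (fst (x t)) = norm (fst (x t\<^sub>0))"
proof -
  have "((\<lambda>t. (norm (fst (x t)))\<^sup>2) has_real_derivative 0) (at u within J)" if "u \<in> J" for u
  proof -
    have "(x has_vector_derivative attitude_dynamics I \<tau> u (x u)) (at u within J)"
      using x that by (simp add: solution_def)
    from norm_power2_has_derivative[OF this] show ?thesis
      by (simp add: attitude_dynamics_def inner_qmult_pure_quat)
  qed
  then have "\<exists>c. \<forall>u\<in>J. (norm (fst (x u)))\<^sup>2 = c"
    by (rule has_field_derivative_zero_constant[OF is_interval_convex[OF J]])
  with mem have "(norm (fst (x t)))\<^sup>2 = (norm (fst (x t\<^sub>0)))\<^sup>2"
    by metis
  then show ?thesis
    by simp
qed

lemma extended_eq_attitude:
  assumes "x \<in> S3 \<times> UNIV"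
  shows "extended_dynamics \<alpha> I \<tau> t x = attitude_dynamics I \<tau> t x"
  using assms by (auto simp: extended_dynamics_def attitude_dynamics_def S3_def)

text \<open>If \<open>s\<close> is 1 at \<open>t\<^sub>0\<close>, the first integral becomes
  \<open>1 - s t\<close> times a positive exponential equal to 0. It holds for \<open>t\<close> on
  either side of \<open>t\<^sub>0\<close>, hence invariance in both time directions.\<close>

lemma extended_invariant: "invariant_set (extended_dynamics \<alpha> I \<tau>) (S3 \<times> UNIV)"
  unfolding invariant_set_def
proof (intro allI impI ballI, elim conjE)
  fix J and x :: "real \<Rightarrow> state" and t\<^sub>0 t
  assume J: "is_interval J" and x: "solution (extended_dynamics \<alpha> I \<tau>) J x"
    and mem: "t\<^sub>0 \<in> J" "t \<in> J" and "x t\<^sub>0 \<in> S3 \<times> UNIV"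
  then have "norm (fst (x t\<^sub>0)) = 1"
    by (auto simp: S3_def)
  with logistic_first_integral[OF J extended_norm_derivative[OF x] mem]
  have "(norm (fst (x t)))\<^sup>2 = 1"
    by simp
  then show "x t \<in> S3 \<times> UNIV"
    by (simp add: S3_def mem_Times_iff power2_eq_1_iff) (smt (verit) norm_ge_zero)
qed

lemma extended_reduces: "reduces_on (extended_dynamics \<alpha> I \<tau>) (S3 \<times> UNIV) (attitude_dynamics I \<tau>)"
  unfolding reduces_on_def
proof (intro conjI allI impI ballI, goal_cases)
  case (1 t x)
  then show ?case
    by (rule extended_eq_attitude)
next
  case (2 J x t\<^sub>0)
  then have J: "is_interval J" "t\<^sub>0 \<in> J" and x0: "x t\<^sub>0 \<in> S3 \<times> UNIV"
    by auto
  \<comment> \<open>Agreement of the vector fields suffices once the whole trajectory lies on the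
    sphere; each of the two dynamics guarantees that separately.\<close>
  have eq: "solution (extended_dynamics \<alpha> I \<tau>) J x = solution (attitude_dynamics I \<tau>) J x"
    if "\<forall>t\<in>J. x t \<in> S3 \<times> UNIV"
    using that by (simp add: solution_def extended_eq_attitude)
  have "\<forall>t\<in>J. x t \<in> S3 \<times> UNIV" if "solution (attitude_dynamics I \<tau>) J x"
  proof
    fix t
    assume "t \<in> J"
    from attitude_norm_constant[OF J(1) that J(2) this] x0 show "x t \<in> S3 \<times> UNIV"
      by (simp add: S3_def mem_Times_iff)
  qed
  moreover have "\<forall>t\<in>J. x t \<in> S3 \<times> UNIV" if "solution (extended_dynamics \<alpha> I \<tau>) J x"
    using extended_invariant[of \<alpha> I \<tau>, unfolded invariant_set_def, rule_format, of J x t\<^sub>0]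
      that J x0 by simp
  ultimately show ?case
    using eq by blast
qed

text \<open>One estimate for both attraction claims: a fixed \<open>m\<close> gives the uniform
  local bound, an \<open>m\<close> depending on the trajectory gives global convergence.\<close>

lemma extended_decay:
  assumes "\<alpha> > 0" and x: "solution (extended_dynamics \<alpha> I \<tau>) {0..} x"
    and m: "0 < m" "m \<le> 1" "m \<le> (norm (fst (x 0)))\<^sup>2" and "t \<ge> 0"
  shows "\<bar>(norm (fst (x t)))\<^sup>2 - 1\<bar>
           \<le> 1 / m * exp (- (2 * \<alpha>) * t) * \<bar>(norm (fst (x 0)))\<^sup>2 - 1\<bar>"
proof -
  define s where "s t = (norm (fst (x t)))\<^sup>2" for t
  define E where "E = exp (2 * \<alpha> * t)"
  \<comment> \<open>\<open>D\<close> is the denominator of the explicit logistic solution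
    \<open>s t = E * s 0 / D\<close>.\<close>
  define D where "D = 1 + (E - 1) * s 0"
  have E: "E \<ge> 1"
    using assms by (simp add: E_def)
  have "(1 - s t) * E * s 0 = (1 - s 0) * s t"
    using logistic_first_integral[OF _ extended_norm_derivative[OF x], of 0 t] \<open>t \<ge> 0\<close>
    by (simp add: s_def E_def)
  then have "(s t - 1) * D = s 0 - 1"
    by (simp add: D_def algebra_simps)
  then have abs: "\<bar>s t - 1\<bar> * \<bar>D\<bar> = \<bar>s 0 - 1\<bar>"
    by (metis abs_mult)
  have "(E - 1) * m \<le> (E - 1) * s 0"
    using m E by (intro mult_left_mono) (auto simp: s_def)
  \<comment> \<open>Here \<open>D\<close> is at least \<open>1 + (E - 1) * m\<close>, and 1 is at
    least \<open>m\<close>.\<close>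
  then have "m * E \<le> D"
    using m by (simp add: D_def algebra_simps)
  then have "\<bar>s t - 1\<bar> * (m * E) \<le> \<bar>s 0 - 1\<bar>"
    unfolding abs[symmetric] by (intro mult_left_mono) auto
  moreover have "m * E > 0"
    using m E by simp
  ultimately have "\<bar>s t - 1\<bar> \<le> \<bar>s 0 - 1\<bar> / (m * E)"
    by (simp add: pos_le_divide_eq)
  then show ?thesis
    by (simp add: s_def E_def exp_minus field_simps)
qed

lemma norm_fst_gt_of_infdist_S3:
  fixes z :: state
  assumes "infdist z (S3 \<times> UNIV) < d"
  shows "1 - d < norm (fst z)"
proof -
  \<comment> \<open>Nonemptiness matters: \<open>infdist\<close> to the empty set is 0 by
    convention, and only otherwise an infimum that yields a nearby point \<open>y\<close>.\<close>
  have "((1, 0), 0) \<in> S3 \<times> (UNIV :: (real^3) set)"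
    by (simp add: S3_def norm_prod_def)
  then have "S3 \<times> (UNIV :: (real^3) set) \<noteq> {}"
    by blast
  with assms obtain y where y: "y \<in> S3 \<times> UNIV" "dist z y < d"
    by (auto simp: infdist_notempty dest!: cInf_lessD[rotated])
  have "norm (fst y) - norm (fst z) \<le> dist (fst z) (fst y)"
    by (metis dist_commute dist_norm norm_triangle_ineq2)
  also have "\<dots> \<le> dist z y"
    by (rule dist_fst_le)
  finally show ?thesis
    using y by (auto simp: S3_def)
qed

lemma extended_local_attractor:
  assumes "\<alpha> > 0"
  shows "S3_local_exponential_attractor (extended_dynamics \<alpha> I \<tau>)"
  unfolding S3_local_exponential_attractor_def
\<comment> \<open>A tube of radius 1/2 keeps the initial norm above 1/2, so its square is at least
  \<open>m = 1/4\<close>, and the constant is \<open>1 / m = 4\<close>. The rate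
  \<open>2 * \<alpha>\<close> is that of the logistic equation linearized at 1.\<close>
proof (rule exI[of _ "1/2"], rule conjI[rotated], rule exI[of _ 4], rule conjI[rotated],
    rule exI[of _ "2 * \<alpha>"], intro conjI allI impI)
  fix x :: "real \<Rightarrow> state" and t :: real
  assume x: "solution (extended_dynamics \<alpha> I \<tau>) {0..} x \<and> infdist (x 0) (S3 \<times> UNIV) < 1/2"
    and "t \<ge> 0"
  then have "1/2 < norm (fst (x 0))"
    using norm_fst_gt_of_infdist_S3 by fastforce
  then have "(1/2)\<^sup>2 \<le> (norm (fst (x 0)))\<^sup>2"
    by (intro power_mono) auto
  then have "1/4 \<le> (norm (fst (x 0)))\<^sup>2"
    by (simp add: power2_eq_square)
  from extended_decay[OF assms, of I \<tau> x "1/4" t] this x \<open>t \<ge> 0\<close>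
  show "\<bar>(norm (fst (x t)))\<^sup>2 - 1\<bar>
          \<le> 4 * exp (- (2 * \<alpha>) * t) * \<bar>(norm (fst (x 0)))\<^sup>2 - 1\<bar>"
    by simp
qed (use assms in auto)

lemma extended_convergence:
  assumes "\<alpha> > 0"
  shows "S3_region_of_convergence (extended_dynamics \<alpha> I \<tau>) (H0 \<times> UNIV)"
  unfolding S3_region_of_convergence_def
proof (intro allI impI, elim conjE)
  fix x :: "real \<Rightarrow> state"
  assume x: "solution (extended_dynamics \<alpha> I \<tau>) {0..} x" and "x 0 \<in> H0 \<times> UNIV"
  \<comment> \<open>Positive because the initial quaternion is nonzero; it tends to 0 with that
    quaternion, so the resulting bound is not uniform over \<open>H0\<close>.\<close>
  define m where "m = min 1 ((norm (fst (x 0)))\<^sup>2)"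
  have m: "0 < m" "m \<le> 1" "m \<le> (norm (fst (x 0)))\<^sup>2"
    using \<open>x 0 \<in> H0 \<times> UNIV\<close> by (auto simp: m_def H0_def)
  let ?d = "\<lambda>t. 1 / m * exp (- (2 * \<alpha>) * t) * \<bar>(norm (fst (x 0)))\<^sup>2 - 1\<bar>"
  have "filterlim (\<lambda>t. - (2 * \<alpha>) * t) at_bot at_top"
    using assms by (intro filterlim_tendsto_neg_mult_at_bot[OF tendsto_const] filterlim_ident) auto
  then have "((\<lambda>t. exp (- (2 * \<alpha>) * t)) \<longlongrightarrow> 0) at_top"
    by (rule filterlim_compose[OF exp_at_bot])
  then have "(?d \<longlongrightarrow> 0) at_top"
    by (intro tendsto_mult_left_zero tendsto_mult_right_zero)
  \<comment> \<open>The decay bound is available only for nonnegative times, which is enough for the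
    limit.\<close>
  moreover have "\<forall>\<^sub>F t in at_top. norm ((norm (fst (x t)))\<^sup>2 - 1) \<le> ?d t"
    using eventually_ge_at_top[of 0]
    by eventually_elim (use extended_decay[OF assms x m] in simp)
  ultimately show "((\<lambda>t. (norm (fst (x t)))\<^sup>2) \<longlongrightarrow> 1) at_top"
    by (subst Lim_null) (rule Lim_null_comparison)
qed

theorem lemma1:
  fixes \<alpha> :: real
    and I :: "real^3^3"
    and \<tau> :: "real \<Rightarrow> state \<Rightarrow> real^3"
  assumes "\<alpha> > 0"
    and "transpose I = I"
    and "\<And>v. v \<noteq> 0 \<Longrightarrow> v \<bullet> (I *v v) > 0"
  shows "reduces_on (extended_dynamics \<alpha> I \<tau>) (S3 \<times> UNIV) (attitude_dynamics I \<tau>)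
    \<and> invariant_set (extended_dynamics \<alpha> I \<tau>) (S3 \<times> UNIV)
    \<and> S3_local_exponential_attractor (extended_dynamics \<alpha> I \<tau>)
    \<and> S3_region_of_convergence (extended_dynamics \<alpha> I \<tau>) (H0 \<times> UNIV)"
  using extended_reduces extended_invariant extended_local_attractor[OF assms(1)]
    extended_convergence[OF assms(1)]
  by blast

end
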